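(* Let $\mathbf{y},\mathbf{z}\in\mathbb{R}^n$ satisfy $$\begin{cases}A_1\mathbf{y}+\lambda_1A_1\mathbf{z}\le\mathbf{b}_1\\ A_1\mathbf{y}+\lambda_2A_1\mathbf{z}\le\mathbf{b}_1\\ (A_2+\lambda_1D)(\mathbf{y}+\lambda_1\mathbf{z})\le\mathbf{b}_2\\ (A_2+\lambda_2D)(\mathbf{y}+\lambda_2\mathbf{z})\le\mathbf{b}_2\\ A_2\mathbf{y}+\lambda_1\lambda_2D\mathbf{z}+\frac{\lambda_1+\lambda_2}{2}(D\mathbf{y}+A_2\mathbf{z})\le\mathbf{b}_2.\end{cases}$$ Then, for all $\lambda\in[\lambda_1,\lambda_2]$, $$A_1(\mathbf{y}+\lambda\mathbf{z})\le\mathbf{b}_1\quad\text{and}\quad (A_2+\lambda D)(\mathbf{y}+\lambda\mathbf{z})\le\mathbf{b}_2.$$ Moreover, if $\mathcal{P}(\lambda)$ is a linear problem (i.e. $n_i=0$), then any such $\mathbf{y},\mathbf{z}$ provide an upper bound: $\mathbf{c}^t(\mathbf{y}+\lambda\mathbf{z})\ge f(\lambda)$ for all $\lambda\in[\lambda_1,\lambda_2]$.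
   Context: Let $n=n_c+n_i$, $\mathbf{c}\in\mathbb{R}^n$, $A_1\in\mathbb{R}^{m_1\times n}$, $A_2,D\in\mathbb{R}^{m_2\times n}$, $\mathbf{b}_1\in\mathbb{R}^{m_1}$, $\mathbf{b}_2\in\mathbb{R}^{m_2}$, and real numbers $\lambda_1\le\lambda_2$. Vector inequalities are componentwise. For $\lambda\in\mathbb{R}$, let $f(\lambda)$ be the optimal value (infimum, in $\mathbb{R}\cup\{\pm\infty\}$, equal to $+\infty$ if infeasible) of $$\mathcal{P}(\lambda):\ \min\ \mathbf{c}^t\mathbf{x}\ \text{ s.t. } A_1\mathbf{x}\le\mathbf{b}_1,\ A_2\mathbf{x}+\lambda D\mathbf{x}\le\mathbf{b}_2,\ \mathbf{x}\in\mathbb{R}^{n_c}\times\mathbb{Z}^{n_i}.$$ *)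

theory Defs
  imports "Jordan_Normal_Form.Matrix" "HOL-Library.Extended_Real"
begin

text \<open>Vectors and matrices are those of \<^theory>\<open>Jordan_Normal_Form.Matrix\<close>, so all dimensions are
  natural numbers and may be zero. There \<open>u \<le> v\<close> means that \<open>u\<close> and \<open>v\<close> have the same dimension
  and that the inequality holds in every component. Indices start at 0, so the integer coordinates
  are \<open>nc, \<dots>, nc + ni - 1\<close>.\<close>

definition mixed_integer_vecs :: "nat \<Rightarrow> nat \<Rightarrow> real vec set" where
  "mixed_integer_vecs nc ni =
     {x \<in> carrier_vec (nc + ni). \<forall>i. nc \<le> i \<and> i < nc + ni \<longrightarrow> x $ i \<in> \<int>}"

definition feasible_set ::
  "nat \<Rightarrow> nat \<Rightarrow> real mat \<Rightarrow> real vec \<Rightarrow> real mat \<Rightarrow> real mat \<Rightarrow> real vec \<Rightarrow> real \<Rightarrow> real vec set" where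
  "feasible_set nc ni A1 b1 A2 D b2 l =
     {x \<in> mixed_integer_vecs nc ni.
        A1 *\<^sub>v x \<le> b1 \<and> A2 *\<^sub>v x + l \<cdot>\<^sub>v (D *\<^sub>v x) \<le> b2}"

text \<open>The infimum is taken in the extended reals: it is \<open>\<infinity>\<close> for an infeasible problem and
  \<open>-\<infinity>\<close> for an unbounded one.\<close>

definition optimal_value ::
  "nat \<Rightarrow> nat \<Rightarrow> real vec \<Rightarrow> real mat \<Rightarrow> real vec \<Rightarrow> real mat \<Rightarrow> real mat \<Rightarrow> real vec \<Rightarrow> real \<Rightarrow> ereal" where
  "optimal_value nc ni c A1 b1 A2 D b2 l =
     (INF x \<in> feasible_set nc ni A1 b1 A2 D b2 l. ereal (c \<bullet> x))"

end

theory Submission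
  imports Defs
begin

text \<open>The second constraint is quadratic in \<open>\<lambda>\<close>, and the last three hypotheses bound its three
  Bernstein coefficients on \<open>[\<lambda>\<^sub>1, \<lambda>\<^sub>2]\<close>. Since the Bernstein basis is nonnegative and sums to one,
  the quadratic is bounded on the whole interval.\<close>

lemma between_convex_comb:
  fixes l :: real
  assumes "l \<in> {l1..l2}"
  obtains t where "0 \<le> t" "t \<le> 1" "l = (1 - t) * l1 + t * l2"
proof (cases "l1 = l2")
  case True
  \<comment> \<open>On a one-point interval the quotient defining \<open>t\<close> below would have
    denominator 0, so the weight 0 is supplied directly.\<close>
  then show thesis using assms that[of 0] by simp
next
  case False
  then have "l1 < l2" using assms by simp
  define t where "t = (l - l1) / (l2 - l1)"
  have "t * (l2 - l1) = l - l1" using \<open>l1 < l2\<close> by (simp add: t_def)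
  then have "l = (1 - t) * l1 + t * l2" by (simp add: algebra_simps)
  moreover have "0 \<le> t" "t \<le> 1" using assms \<open>l1 < l2\<close> by (simp_all add: t_def)
  ultimately show thesis using that by blast
qed

lemma affine_le_between:
  fixes p q b :: real
  assumes "l \<in> {l1..l2}" and "p + l1 * q \<le> b" and "p + l2 * q \<le> b"
  shows "p + l * q \<le> b"
proof -
  obtain t where t: "0 \<le> t" "t \<le> 1" "l = (1 - t) * l1 + t * l2"
    using assms(1) by (rule between_convex_comb)
  have "p + l * q = (1 - t) * (p + l1 * q) + t * (p + l2 * q)"
    unfolding t(3) by (simp add: algebra_simps)
  also have "\<dots> \<le> b"
    using t assms by (intro convex_bound_le) auto
  finally show ?thesis .
qed

text \<open>This is de Casteljau's algorithm in degree two. With the polar form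
  \<open>B(u,v) = p + (u + v) / 2 * q + u * v * r\<close>, the three bounds are on
  \<open>B(l1,l1)\<close>, \<open>B(l2,l2)\<close> and \<open>B(l1,l2)\<close>, and the quadratic is
  \<open>B(l,l)\<close>.\<close>

lemma quadratic_le_between:
  fixes p q r b :: real
  assumes l: "l \<in> {l1..l2}"
    and e1: "p + l1 * q + l1\<^sup>2 * r \<le> b"
    and e2: "p + l2 * q + l2\<^sup>2 * r \<le> b"
    and mid: "p + (l1 + l2) / 2 * q + l1 * l2 * r \<le> b"
  shows "p + l * q + l\<^sup>2 * r \<le> b"
proof -
  obtain t where t: "0 \<le> t" "t \<le> 1" "l = (1 - t) * l1 + t * l2"
    using l by (rule between_convex_comb)
  let ?m = "p + (l1 + l2) / 2 * q + l1 * l2 * r"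
  \<comment> \<open>The inner combinations are \<open>B(l1,l)\<close> and \<open>B(l,l2)\<close>,
    since \<open>B\<close> is affine in each argument; combining them with the same weights gives
    \<open>B(l,l)\<close>. The bound \<open>b\<close> thus survives two rounds of convex
    combination.\<close>
  have "p + l * q + l\<^sup>2 * r =
      (1 - t) * ((1 - t) * (p + l1 * q + l1\<^sup>2 * r) + t * ?m)
      + t * ((1 - t) * ?m + t * (p + l2 * q + l2\<^sup>2 * r))"
    unfolding t(3) by (simp add: field_simps power2_eq_square)
  also have "\<dots> \<le> b"
    using t e1 e2 mid by (intro convex_bound_le) auto
  finally show ?thesis .
qed

lemma mult_mat_vec_add_smult:
  fixes A :: "'a :: comm_ring_1 mat"
  assumes "A \<in> carrier_mat m n" "y \<in> carrier_vec n" "z \<in> carrier_vec n"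
  shows "A *\<^sub>v (y + l \<cdot>\<^sub>v z) = A *\<^sub>v y + l \<cdot>\<^sub>v (A *\<^sub>v z)"
  using assms by (intro eq_vecI) (auto simp: scalar_prod_add_distrib[of _ n])

lemma add_smult_mat_mult_vec:
  fixes A D :: "'a :: comm_ring_1 mat"
  assumes "A \<in> carrier_mat m n" "D \<in> carrier_mat m n" "x \<in> carrier_vec n"
  shows "(A + l \<cdot>\<^sub>m D) *\<^sub>v x = A *\<^sub>v x + l \<cdot>\<^sub>v (D *\<^sub>v x)"
  using assms by (intro eq_vecI) (auto simp: add_scalar_prod_distrib[of _ n])

text \<open>Supplies the coefficients \<open>p\<close>, \<open>q\<close>, \<open>r\<close> for
  \<open>quadratic_le_between\<close> in each row; the two cross terms of the product make up
  \<open>q\<close>.\<close>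

lemma index_param_mat_mult_param_vec:
  fixes A D :: "'a :: comm_ring_1 mat"
  assumes "A \<in> carrier_mat m n" "D \<in> carrier_mat m n" "y \<in> carrier_vec n" "z \<in> carrier_vec n" "i < m"
  shows "((A + l \<cdot>\<^sub>m D) *\<^sub>v (y + l \<cdot>\<^sub>v z)) $ i =
    (A *\<^sub>v y) $ i + l * ((D *\<^sub>v y) $ i + (A *\<^sub>v z) $ i) + l\<^sup>2 * (D *\<^sub>v z) $ i"
proof -
  have "y + l \<cdot>\<^sub>v z \<in> carrier_vec n" using assms by simp
  moreover have "dim_row A = m" "dim_row D = m" using assms by auto
  ultimately show ?thesis
    \<comment> \<open>Removing \<open>index_mult_mat_vec\<close> keeps entries such as
      \<open>(A *\<^sub>v y) $ i\<close> atomic, so that only scalar algebra remains.\<close>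
    using assms(5)
    by (simp add: add_smult_mat_mult_vec[OF assms(1,2)] mult_mat_vec_add_smult[OF assms(1,3,4)]
        mult_mat_vec_add_smult[OF assms(2,3,4)] algebra_simps power2_eq_square
        del: index_mult_mat_vec)
qed

theorem theorem2:
  fixes nc ni m1 m2 :: nat
    and c b1 b2 y z :: "real vec"
    and A1 A2 D :: "real mat"
    and l1 l2 :: real
  assumes "c \<in> carrier_vec (nc + ni)"
    and "A1 \<in> carrier_mat m1 (nc + ni)"
    and "A2 \<in> carrier_mat m2 (nc + ni)"
    and "D \<in> carrier_mat m2 (nc + ni)"
    and "b1 \<in> carrier_vec m1"
    and "b2 \<in> carrier_vec m2"
    and "l1 \<le> l2"
    and "y \<in> carrier_vec (nc + ni)"
    and "z \<in> carrier_vec (nc + ni)"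
    and "A1 *\<^sub>v y + l1 \<cdot>\<^sub>v (A1 *\<^sub>v z) \<le> b1"
    and "A1 *\<^sub>v y + l2 \<cdot>\<^sub>v (A1 *\<^sub>v z) \<le> b1"
    and "(A2 + l1 \<cdot>\<^sub>m D) *\<^sub>v (y + l1 \<cdot>\<^sub>v z) \<le> b2"
    and "(A2 + l2 \<cdot>\<^sub>m D) *\<^sub>v (y + l2 \<cdot>\<^sub>v z) \<le> b2"
    and "A2 *\<^sub>v y + (l1 * l2) \<cdot>\<^sub>v (D *\<^sub>v z)
           + ((l1 + l2) / 2) \<cdot>\<^sub>v (D *\<^sub>v y + A2 *\<^sub>v z) \<le> b2"
  shows "(\<forall>l \<in> {l1..l2}.
            A1 *\<^sub>v (y + l \<cdot>\<^sub>v z) \<le> b1 \<and>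
            (A2 + l \<cdot>\<^sub>m D) *\<^sub>v (y + l \<cdot>\<^sub>v z) \<le> b2) \<and>
         (ni = 0 \<longrightarrow>
            (\<forall>l \<in> {l1..l2}.
               ereal (c \<bullet> (y + l \<cdot>\<^sub>v z)) \<ge> optimal_value nc ni c A1 b1 A2 D b2 l))"
proof -
  note A1 = assms(2) and A2 = assms(3) and D = assms(4)
    and b1 = assms(5) and b2 = assms(6) and y = assms(8) and z = assms(9)
  have rows: "dim_row A1 = m1" "dim_row A2 = m2" "dim_row D = m2" "dim_vec b1 = m1" "dim_vec b2 = m2"
    using A1 A2 D b1 b2 by auto
  \<comment> \<open>With \<open>A1\<close> constant, each row is affine in \<open>l\<close>, so the
    two endpoint bounds suffice.\<close>
  have feas1: "A1 *\<^sub>v (y + l \<cdot>\<^sub>v z) \<le> b1" if l: "l \<in> {l1..l2}" for l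
    using assms(10,11) affine_le_between[OF l]
    by (simp add: mult_mat_vec_add_smult[OF A1 y z] less_eq_vec_def rows del: index_mult_mat_vec)
  have feas2: "(A2 + l \<cdot>\<^sub>m D) *\<^sub>v (y + l \<cdot>\<^sub>v z) \<le> b2" if l: "l \<in> {l1..l2}" for l
  proof -
    have "((A2 + l \<cdot>\<^sub>m D) *\<^sub>v (y + l \<cdot>\<^sub>v z)) $ i \<le> b2 $ i" if i: "i < m2" for i
    proof -
      \<comment> \<open>The parameter stays schematic here, so one expansion serves at
        \<open>l1\<close>, \<open>l2\<close> and \<open>l\<close>.\<close>
      note idx = index_param_mat_mult_param_vec[OF A2 D y z i]
      have e1: "((A2 + l1 \<cdot>\<^sub>m D) *\<^sub>v (y + l1 \<cdot>\<^sub>v z)) $ i \<le> b2 $ i"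
        and e2: "((A2 + l2 \<cdot>\<^sub>m D) *\<^sub>v (y + l2 \<cdot>\<^sub>v z)) $ i \<le> b2 $ i"
        using assms(12,13) i rows by (simp_all add: less_eq_vec_def del: index_mult_mat_vec)
      \<comment> \<open>Row \<open>i\<close> of the last hypothesis is exactly the middle Bernstein
        coefficient, up to the order of the summands.\<close>
      have mid: "(A2 *\<^sub>v y) $ i + (l1 + l2) / 2 * ((D *\<^sub>v y) $ i + (A2 *\<^sub>v z) $ i)
          + l1 * l2 * (D *\<^sub>v z) $ i \<le> b2 $ i"
        using assms(14) i rows by (simp add: less_eq_vec_def add_ac del: index_mult_mat_vec)
      show ?thesis
        using quadratic_le_between[OF l e1[unfolded idx] e2[unfolded idx] mid] unfolding idx .
    qed
    then show ?thesis using rows by (simp add: less_eq_vec_def del: index_mult_mat_vec)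
  qed
  have bound: "optimal_value nc ni c A1 b1 A2 D b2 l \<le> ereal (c \<bullet> (y + l \<cdot>\<^sub>v z))"
    if "ni = 0" and l: "l \<in> {l1..l2}" for l
  proof -
    have x: "y + l \<cdot>\<^sub>v z \<in> carrier_vec (nc + ni)" using y z by simp
    \<comment> \<open>For \<open>ni = 0\<close> the integrality condition ranges over no index, so
      the two inequalities already give feasibility.\<close>
    have "y + l \<cdot>\<^sub>v z \<in> feasible_set nc ni A1 b1 A2 D b2 l"
      using x feas1[OF l] feas2[OF l] \<open>ni = 0\<close>
      by (auto simp: feasible_set_def mixed_integer_vecs_def add_smult_mat_mult_vec[OF A2 D x])
    then show ?thesis unfolding optimal_value_def by (rule INF_lower)
  qed
  show ?thesis using feas1 feas2 bound by blast
qed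

end
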